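(* Let $G$ be a claw-free graph with $n$ vertices. Then $\operatorname{lcc}(G)+\chi(G)\leq n+1$. Moreover, for every $n\ge 4$ there exist several (pairwise non-isomorphic) claw-free graphs $G$ with $n$ vertices for which $\operatorname{lcc}(G)+\chi(G)=n+1$.
   Context: All graphs are finite, simple and undirected; $\chi(G)$ is the chromatic number. A graph is claw-free if it contains no induced subgraph isomorphic to $K_{1,3}$. A clique of $G$ is a set of pairwise adjacent vertices. A clique covering of $E(G)$ is a family $\mathcal{C}$ of cliques of $G$ such that every edge of $G$ lies in at least one member of $\mathcal{C}$; $val_{\mathcal{C}}(v)$ is the number of cliques in $\mathcal{C}$ containing $v$. The local clique cover number $\operatorname{lcc}(G)$ is the smallest integer $k$ such that there is a clique covering $\mathcal{C}$ of $E(G)$ with $val_{\mathcal{C}}(v)\le k$ for every vertex $v$. *)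

theory Defs
  imports "Graph_Theory.Digraph_Isomorphism" "Graph_Theory.Kuratowski"
begin

text \<open>
  Finite simple undirected graphs are the locale \<^locale>\<open>graph\<close>: finite loop-free symmetric digraphs
  without parallel arcs. An undirected edge is a pair of opposite arcs.
\<close>

definition claw_free :: "('a, 'b) pre_digraph \<Rightarrow> bool" where
  "claw_free G \<longleftrightarrow> \<not> (\<exists>H. induced_subgraph H G \<and> K\<^bsub>1,3\<^esub> H)"

definition proper_coloring :: "('a, 'b) pre_digraph \<Rightarrow> nat \<Rightarrow> ('a \<Rightarrow> nat) \<Rightarrow> bool" where
  "proper_coloring G k c \<longleftrightarrow>
     (\<forall>v \<in> verts G. c v < k) \<and> (\<forall>(u, v) \<in> arcs_ends G. c u \<noteq> c v)"

definition chromatic_number :: "('a, 'b) pre_digraph \<Rightarrow> nat" where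
  "chromatic_number G = (LEAST k. \<exists>c. proper_coloring G k c)"

definition clique :: "('a, 'b) pre_digraph \<Rightarrow> 'a set \<Rightarrow> bool" where
  "clique G K \<longleftrightarrow> K \<subseteq> verts G \<and> (\<forall>u \<in> K. \<forall>v \<in> K. u \<noteq> v \<longrightarrow> (u, v) \<in> arcs_ends G)"

text \<open>
  Families of cliques are sets: a repeated clique can only increase the valencies, so multiplicities
  are irrelevant to the minimum defining \<open>lcc\<close> below.
\<close>

definition clique_covering :: "('a, 'b) pre_digraph \<Rightarrow> 'a set set \<Rightarrow> bool" where
  "clique_covering G \<C> \<longleftrightarrow>
     (\<forall>K \<in> \<C>. clique G K) \<and> (\<forall>(u, v) \<in> arcs_ends G. \<exists>K \<in> \<C>. u \<in> K \<and> v \<in> K)"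

definition valency :: "'a set set \<Rightarrow> 'a \<Rightarrow> nat" where
  "valency \<C> v = card {K \<in> \<C>. v \<in> K}"

definition lcc :: "('a, 'b) pre_digraph \<Rightarrow> nat" where
  "lcc G = (LEAST k. \<exists>\<C>. clique_covering G \<C> \<and> (\<forall>v \<in> verts G. valency \<C> v \<le> k))"

end

theory Submission
  imports Defs
begin

text \<open>
  Write \<open>\<theta>(W)\<close> for the chromatic number of the complement of \<open>G[W]\<close>. Nordhaus and Gaddum's
  \<open>\<chi>(W) + \<theta>(W) \<le> |W| + 1\<close> gives \<open>\<theta>(W) \<le> n + 1 - \<chi>(G)\<close> for every \<open>W\<close>, so the edges at a vertex can
  be covered within the allowed valency by partitioning its neighbourhood into cliques, and each
  neighbour then pays only one clique. By induction on \<open>n\<close>, a set \<open>S\<close> may be removed if restoring it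
  costs every other vertex at most \<open>|S| - (\<chi>(G) - \<chi>(G - S))\<close> cliques. This holds for an independent
  triple, since in a claw-free graph a vertex has at most two neighbours in it. If there is no such
  triple, it holds for two disjoint nonadjacent pairs \<open>a\<^sub>1b\<^sub>1\<close>, \<open>a\<^sub>2b\<^sub>2\<close>, labelled so that \<open>a\<^sub>1a\<^sub>2\<close> and
  \<open>b\<^sub>1b\<^sub>2\<close> are edges: common neighbours of \<open>a\<^sub>1\<close> and \<open>a\<^sub>2\<close> are served by cliques containing both. If
  there are no two such pairs either, \<open>G\<close> is a clique up to one vertex.
\<close>

section \<open>Colourings of relations\<close>

text \<open>A relation with a separate vertex set makes induced subgraphs mere changes of
  \<open>V\<close>, which suits an induction that deletes vertices, and lets the same notion serve
  for the complement.\<close>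

definition colorable :: "('a \<Rightarrow> 'a \<Rightarrow> bool) \<Rightarrow> 'a set \<Rightarrow> nat \<Rightarrow> bool" where
  "colorable E V k \<longleftrightarrow>
     (\<exists>c :: 'a \<Rightarrow> nat. (\<forall>v \<in> V. c v < k) \<and> (\<forall>u \<in> V. \<forall>v \<in> V. E u v \<longrightarrow> c u \<noteq> c v))"

definition chi :: "('a \<Rightarrow> 'a \<Rightarrow> bool) \<Rightarrow> 'a set \<Rightarrow> nat" where
  "chi E V = (LEAST k. colorable E V k)"

text \<open>Adjacency in the complement graph. Colour classes for it are cliques of
  \<open>E\<close>, so \<open>chi (nonadj E) W\<close> is the least number of cliques that partition
  \<open>W\<close>.\<close>

definition nonadj :: "('a \<Rightarrow> 'a \<Rightarrow> bool) \<Rightarrow> 'a \<Rightarrow> 'a \<Rightarrow> bool" where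
  "nonadj E u v \<longleftrightarrow> u \<noteq> v \<and> \<not> E u v"

lemma nonadj_sym: "symp E \<Longrightarrow> symp (nonadj E)"
  by (auto simp: symp_def nonadj_def)

lemma nonadj_irrefl: "irreflp (nonadj E)"
  by (auto simp: irreflp_def nonadj_def)

lemma colorable_mono: "colorable E V k \<Longrightarrow> k \<le> l \<Longrightarrow> colorable E V l"
  unfolding colorable_def by (fastforce intro: less_le_trans)

lemma chi_le: "colorable E V k \<Longrightarrow> chi E V \<le> k"
  unfolding chi_def by (rule Least_le)

lemma colorable_card:
  assumes "finite V" "irreflp E"
  shows "colorable E V (card V)"
proof -
  obtain c :: "'a \<Rightarrow> nat" where c: "bij_betw c V {..<card V}"
    using assms(1) ex_bij_betw_finite_nat[of V] by (auto simp: atLeast0LessThan)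
  have "c u \<noteq> c v" if "u \<in> V" "v \<in> V" "E u v" for u v
    using c that assms(2) by (metis bij_betw_def inj_on_def irreflp_def)
  then show ?thesis
    unfolding colorable_def using c by (metis bij_betwE lessThan_iff)
qed

lemma colorable_chi: "finite V \<Longrightarrow> irreflp E \<Longrightarrow> colorable E V (chi E V)"
  unfolding chi_def by (rule LeastI, rule colorable_card)

lemma chi_le_card: "finite V \<Longrightarrow> irreflp E \<Longrightarrow> chi E V \<le> card V"
  by (simp add: chi_le colorable_card)

lemma colorable_Un_independent:
  assumes "colorable E V k" "\<And>u v. u \<in> S \<Longrightarrow> v \<in> S \<Longrightarrow> \<not> E u v"
  shows "colorable E (V \<union> S) (Suc k)"
proof -
  obtain c where c: "\<forall>v \<in> V. c v < k" "\<forall>u \<in> V. \<forall>v \<in> V. E u v \<longrightarrow> c u \<noteq> c v"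
    using assms(1) unfolding colorable_def by auto
  show ?thesis
    unfolding colorable_def
  proof (rule exI[of _ "\<lambda>v. if v \<in> S then k else c v"], intro conjI ballI impI)
    fix v assume "v \<in> V \<union> S"
    then show "(if v \<in> S then k else c v) < Suc k" using c(1) by (auto intro: less_SucI)
  next
    fix u v assume "u \<in> V \<union> S" "v \<in> V \<union> S" "E u v"
    then show "(if u \<in> S then k else c u) \<noteq> (if v \<in> S then k else c v)"
      using c assms(2)[of u v] by (auto dest: less_not_refl2)
  qed
qed

lemma chi_Un_independent:
  assumes "finite V" "irreflp E" "\<And>u v. u \<in> S \<Longrightarrow> v \<in> S \<Longrightarrow> \<not> E u v"
  shows "chi E (V \<union> S) \<le> Suc (chi E V)"
  by (rule chi_le, rule colorable_Un_independent, rule colorable_chi) (use assms in auto)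

lemma chi_Un_card:
  assumes "finite V" "finite S" "irreflp E"
  shows "chi E (V \<union> S) \<le> chi E V + card S"
  using assms(2)
proof (induction S rule: finite_induct)
  case (insert x S)
  have "chi E ((V \<union> S) \<union> {x}) \<le> Suc (chi E (V \<union> S))"
    using assms insert.hyps by (intro chi_Un_independent) (auto simp: irreflp_def)
  with insert show ?case by simp
qed simp

section \<open>Greedy colouring and the Nordhaus-Gaddum bound\<close>

lemma colorable_insert:
  assumes "symp E" "irreflp E" "finite V" "v \<notin> V" "colorable E V k" "card {u \<in> V. E v u} < k"
  shows "colorable E (insert v V) k"
proof -
  obtain c where c: "\<forall>v \<in> V. c v < k" "\<forall>u \<in> V. \<forall>v \<in> V. E u v \<longrightarrow> c u \<noteq> c v"
    using assms(5) unfolding colorable_def by auto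
  have "card (c ` {u \<in> V. E v u}) < card {..<k}"
    using assms(3,6) card_image_le[of "{u \<in> V. E v u}" c] by simp
  then obtain j where j: "j < k" "j \<notin> c ` {u \<in> V. E v u}"
    using card_mono[of "c ` {u \<in> V. E v u}" "{..<k}"] assms(3) by fastforce
  show ?thesis
    unfolding colorable_def
  proof (rule exI[of _ "c(v := j)"], intro conjI ballI impI)
    fix u assume "u \<in> insert v V"
    then show "(c(v := j)) u < k" using c j by auto
  next
    fix u w assume uw: "u \<in> insert v V" "w \<in> insert v V" "E u w"
    then have "E w u" "u \<noteq> w" using assms(1,2) by (auto dest: sympD irreflpD)
    with uw consider "u = v" "w \<in> V" "w \<noteq> v" "E v w" | "w = v" "u \<in> V" "u \<noteq> v" "E v u"
      | "u \<noteq> v" "w \<noteq> v" "u \<in> V" "w \<in> V" by auto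
    then show "(c(v := j)) u \<noteq> (c(v := j)) w"
      using c(2) j(2) uw(3) by cases auto
  qed
qed

text \<open>Induction on \<open>W\<close>. A new vertex \<open>v\<close> raises each chromatic
  number by at most one, and raises it only if the degree of \<open>v\<close> in that relation is at
  least the old value. The two degrees of \<open>v\<close> sum to \<open>card W\<close>, so if both
  numbers rise, the old sum was at most \<open>card W\<close>; otherwise the induction hypothesis
  suffices.\<close>

lemma nordhaus_gaddum:
  assumes "finite W" "symp E" "irreflp E"
  shows "chi E W + chi (nonadj E) W \<le> card W + 1"
  using assms(1)
proof (induction W rule: finite_induct)
  case empty
  show ?case using chi_le_card[of "{}" E] chi_le_card[OF _ nonadj_irrefl, of "{}" E] assms by simp
next
  case (insert v W)
  let ?N = "nonadj E"
  have N: "symp ?N" "irreflp ?N" using assms nonadj_sym nonadj_irrefl by auto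
  have deg: "card {u \<in> W. E v u} + card {u \<in> W. ?N v u} = card W"
  proof -
    have "W = {u \<in> W. E v u} \<union> {u \<in> W. ?N v u}" "{u \<in> W. E v u} \<inter> {u \<in> W. ?N v u} = {}"
      using insert.hyps by (auto simp: nonadj_def)
    then show ?thesis using insert.hyps(1)
      by (metis (no_types, lifting) card_Un_disjoint finite_Un)
  qed
  have step: "chi E (insert v W) \<le> Suc (chi E W)" "chi ?N (insert v W) \<le> Suc (chi ?N W)"
    using chi_Un_card[of W "{v}"] insert.hyps assms N by (simp_all add: Un_commute)
  have free: "chi E (insert v W) \<le> chi E W" if "card {u \<in> W. E v u} < chi E W"
    by (rule chi_le, rule colorable_insert) (use assms insert.hyps that colorable_chi in auto)
  have freeN: "chi ?N (insert v W) \<le> chi ?N W" if "card {u \<in> W. ?N v u} < chi ?N W"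
    by (rule chi_le, rule colorable_insert) (use N insert.hyps that colorable_chi in auto)
  have "card (insert v W) = Suc (card W)" using insert.hyps by simp
  with deg step free freeN insert.IH show ?case by linarith
qed

text \<open>Apply \<open>nordhaus_gaddum\<close> to \<open>W\<close>; every vertex of
  \<open>V - W\<close> adds at most one colour and exactly one to the cardinality.\<close>

lemma chi_nonadj_subset:
  assumes "finite V" "symp E" "irreflp E" "W \<subseteq> V"
  shows "chi (nonadj E) W + chi E V \<le> card V + 1"
proof -
  have "finite W" using assms finite_subset by auto
  moreover have "W \<union> (V - W) = V" "card V = card W + card (V - W)"
    using assms by (auto simp: card_Diff_subset card_mono \<open>finite W\<close>)
  ultimately show ?thesis
    using nordhaus_gaddum[of W E] chi_Un_card[of W "V - W" E] assms by auto
qed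

section \<open>Clique coverings of relations\<close>

definition cliq :: "('a \<Rightarrow> 'a \<Rightarrow> bool) \<Rightarrow> 'a set \<Rightarrow> 'a set \<Rightarrow> bool" where
  "cliq E V K \<longleftrightarrow> K \<subseteq> V \<and> (\<forall>u \<in> K. \<forall>v \<in> K. u \<noteq> v \<longrightarrow> E u v)"

definition coverable :: "('a \<Rightarrow> 'a \<Rightarrow> bool) \<Rightarrow> 'a set \<Rightarrow> nat \<Rightarrow> bool" where
  "coverable E V k \<longleftrightarrow>
     (\<exists>\<C>. (\<forall>K \<in> \<C>. cliq E V K) \<and> (\<forall>u \<in> V. \<forall>v \<in> V. E u v \<longrightarrow> (\<exists>K \<in> \<C>. u \<in> K \<and> v \<in> K)) \<and>
       (\<forall>v \<in> V. valency \<C> v \<le> k))"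

lemma valency_Un: "valency (A \<union> B) v \<le> valency A v + valency B v"
proof -
  have "{K \<in> A \<union> B. v \<in> K} = {K \<in> A. v \<in> K} \<union> {K \<in> B. v \<in> K}" by auto
  then show ?thesis unfolding valency_def by (simp add: card_Un_le)
qed

lemma valency_insert: "valency (insert K A) v \<le> (if v \<in> K then 1 else 0) + valency A v"
proof -
  have "{L \<in> {K}. v \<in> L} = (if v \<in> K then {K} else {})" by auto
  then have "valency {K} v = (if v \<in> K then 1 else 0)" unfolding valency_def by simp
  then show ?thesis using valency_Un[of "{K}" A v] by simp
qed

lemma valency_empty: "valency {} v = 0"
  by (simp add: valency_def)

lemma valency_eq_0: "(\<And>K. K \<in> A \<Longrightarrow> v \<notin> K) \<Longrightarrow> valency A v = 0"
  unfolding valency_def by (auto simp: card_eq_0_iff)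

lemma cliq_mono: "cliq E V K \<Longrightarrow> V \<subseteq> W \<Longrightarrow> cliq E W K"
  unfolding cliq_def by auto

text \<open>The accounting behind every deletion step. \<open>F\<close> takes care of all edges that
  meet \<open>S\<close>. A vertex of \<open>R\<close> pays for the old covering and for
  \<open>F\<close>, whereas a vertex of \<open>S\<close> lies in no old clique and may spend all of
  \<open>m\<close> on \<open>F\<close>.\<close>

lemma coverable_extend:
  assumes "symp E" "coverable E R k" "R \<inter> S = {}"
    and F: "\<And>K. K \<in> F \<Longrightarrow> cliq E (R \<union> S) K"
    and edges: "\<And>u v. u \<in> S \<Longrightarrow> v \<in> R \<union> S \<Longrightarrow> E u v \<Longrightarrow> \<exists>K \<in> F. u \<in> K \<and> v \<in> K"
    and R: "\<And>v. v \<in> R \<Longrightarrow> valency F v \<le> j" and "k + j \<le> m"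
    and S: "\<And>v. v \<in> S \<Longrightarrow> valency F v \<le> m"
  shows "coverable E (R \<union> S) m"
proof -
  obtain C where "\<forall>K \<in> C. cliq E R K"
      "\<forall>u \<in> R. \<forall>v \<in> R. E u v \<longrightarrow> (\<exists>K \<in> C. u \<in> K \<and> v \<in> K)" "\<forall>v \<in> R. valency C v \<le> k"
    using assms(2) unfolding coverable_def by (elim exE conjE)
  note C = this[rule_format]
  show ?thesis
    unfolding coverable_def
  proof (rule exI[of _ "C \<union> F"], intro conjI ballI impI)
    fix K assume "K \<in> C \<union> F"
    then show "cliq E (R \<union> S) K" using F C(1)[THEN cliq_mono, of K "R \<union> S"] by auto
  next
    fix u v assume "u \<in> R \<union> S" "v \<in> R \<union> S" "E u v"
    moreover from this have "E v u" using assms(1) by (auto simp: symp_def)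
    ultimately show "\<exists>K \<in> C \<union> F. u \<in> K \<and> v \<in> K"
      using C(2)[of u v] edges[of u v] edges[of v u] by blast
  next
    fix v assume v: "v \<in> R \<union> S"
    have le: "valency (C \<union> F) v \<le> valency C v + valency F v" by (rule valency_Un)
    show "valency (C \<union> F) v \<le> m"
    proof (cases "v \<in> R")
      case True
      then show ?thesis using le C(3)[of v] R[of v] assms(7) by simp
    next
      case False
      then have "valency C v = 0" using C(1) by (intro valency_eq_0) (auto simp: cliq_def)
      then show ?thesis using le S[of v] v False by auto
    qed
  qed
qed

text \<open>The colour classes of the complement on \<open>W\<close> are cliques; joining
  \<open>X\<close> to each of them keeps them cliques. A vertex of \<open>W\<close> lies in one
  class only, so only \<open>X\<close> pays for all \<open>k\<close> cliques.\<close>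

lemma join_family:
  assumes "symp E" "colorable (nonadj E) W k" "cliq E X X" "X \<inter> W = {}"
    and join: "\<And>x w. x \<in> X \<Longrightarrow> w \<in> W \<Longrightarrow> E x w"
  obtains F where "\<And>K. K \<in> F \<Longrightarrow> cliq E (X \<union> W) K"
    "\<And>w. w \<in> W \<Longrightarrow> \<exists>K \<in> F. insert w X \<subseteq> K"
    "0 < k \<Longrightarrow> \<exists>K \<in> F. X \<subseteq> K"
    "\<And>v. valency F v \<le> k"
    "\<And>w. w \<in> W \<Longrightarrow> valency F w \<le> 1"
proof -
  obtain c where c: "\<forall>w \<in> W. c w < k" "\<forall>u \<in> W. \<forall>v \<in> W. nonadj E u v \<longrightarrow> c u \<noteq> c v"
    using assms(2) unfolding colorable_def by auto
  define F where "F = (\<lambda>i. X \<union> {w \<in> W. c w = i}) ` {..<k}"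
  have 1: "cliq E (X \<union> W) K" if "K \<in> F" for K
  proof -
    obtain i where i: "K = X \<union> {w \<in> W. c w = i}" using \<open>K \<in> F\<close> unfolding F_def by auto
    have "E u v" if "u \<in> K" "v \<in> K" "u \<noteq> v" for u v
    proof -
      have "E w x" if "x \<in> X" "w \<in> W" for x w
        using join[OF that] assms(1) by (rule sympD[rotated])
      moreover have "E u v" if "u \<in> W" "v \<in> W" "c u = c v"
        using c(2) that \<open>u \<noteq> v\<close> unfolding nonadj_def by auto
      ultimately show ?thesis using \<open>u \<in> K\<close> \<open>v \<in> K\<close> \<open>u \<noteq> v\<close> assms(3) join unfolding i cliq_def by auto
    qed
    then show ?thesis unfolding cliq_def i by auto
  qed
  have 2: "\<exists>K \<in> F. insert w X \<subseteq> K" if "w \<in> W" for w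
    using that c(1) unfolding F_def by auto
  have 3: "\<exists>K \<in> F. X \<subseteq> K" if "0 < k"
    using that unfolding F_def by auto
  have 4: "valency F v \<le> k" for v
  proof -
    have "valency F v \<le> card F"
      unfolding valency_def F_def by (intro card_mono) auto
    also have "\<dots> \<le> k" unfolding F_def using card_image_le[of "{..<k}"] by simp
    finally show ?thesis .
  qed
  have 5: "valency F w \<le> 1" if "w \<in> W" for w
  proof -
    have "{K \<in> F. w \<in> K} \<subseteq> {X \<union> {u \<in> W. c u = c w}}"
      using that assms(4) unfolding F_def by auto
    then show ?thesis unfolding valency_def using card_mono[of "{X \<union> {u \<in> W. c u = c w}}"] by simp
  qed
  from 1 2 3 4 5 show ?thesis by (rule that)
qed

text \<open>\<open>join_family\<close> with \<open>X = {a}\<close> and \<open>W\<close> the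
  neighbourhood of \<open>a\<close> in \<open>R\<close>. Non-neighbours pay nothing, so the costs of
  several such families at a vertex of \<open>R\<close> add up to at most the number of its
  neighbours among the restored vertices.\<close>

lemma vertex_family:
  assumes "symp E" "a \<notin> R" "colorable (nonadj E) {w \<in> R. E a w} k"
  obtains F where "\<And>K. K \<in> F \<Longrightarrow> cliq E (insert a R) K"
    "\<And>w. w \<in> R \<Longrightarrow> E a w \<Longrightarrow> \<exists>K \<in> F. a \<in> K \<and> w \<in> K"
    "valency F a \<le> k"
    "\<And>w. w \<in> R \<Longrightarrow> valency F w \<le> (if E a w then 1 else 0)"
    "\<And>w. w \<notin> insert a R \<Longrightarrow> valency F w = 0"
proof -
  have X: "cliq E {a} {a}" "{a} \<inter> {w \<in> R. E a w} = {}"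
    and join: "\<And>x w. x \<in> {a} \<Longrightarrow> w \<in> {w \<in> R. E a w} \<Longrightarrow> E x w"
    using assms(2) by (auto simp: cliq_def)
  obtain F where F:
    "\<And>K. K \<in> F \<Longrightarrow> cliq E ({a} \<union> {w \<in> R. E a w}) K"
    "\<And>w. w \<in> {w \<in> R. E a w} \<Longrightarrow> \<exists>K \<in> F. insert w {a} \<subseteq> K"
    "0 < k \<Longrightarrow> \<exists>K \<in> F. {a} \<subseteq> K"
    "\<And>v. valency F v \<le> k" "\<And>w. w \<in> {w \<in> R. E a w} \<Longrightarrow> valency F w \<le> 1"
    using join_family[OF assms(1,3) X join] by blast
  have "cliq E (insert a R) K" if "K \<in> F" for K
    using F(1)[OF that] by (rule cliq_mono) auto
  moreover have "\<exists>K \<in> F. a \<in> K \<and> w \<in> K" if "w \<in> R" "E a w" for w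
    using F(2)[of w] that by auto
  moreover have zero: "valency F w = 0" if "w \<noteq> a" "\<not> (w \<in> R \<and> E a w)" for w
    using F(1) that by (intro valency_eq_0) (auto simp: cliq_def)
  moreover have "valency F w \<le> (if E a w then 1 else 0)" if "w \<in> R" for w
    using F(5)[of w] zero[of w] that assms(2) by (cases "E a w") auto
  ultimately show ?thesis
    using F(4)[of a] that[of F] by blast
qed

text \<open>Common neighbours are covered by cliques through both \<open>a\<close> and
  \<open>b\<close>; the private neighbours of each end, being a clique, form one further clique with
  that end. Every vertex of \<open>R\<close> is of at most one of these three kinds and pays at most
  one, while each end pays one beyond \<open>k\<close>. The condition \<open>0 < k\<close> puts the
  edge \<open>a b\<close> itself into a clique.\<close>

lemma edge_family:
  assumes "symp E" "irreflp E" "a \<notin> R" "b \<notin> R" "E a b" "0 < k"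
    and "colorable (nonadj E) {w \<in> R. E a w \<and> E b w} k"
    and "cliq E R {w \<in> R. E a w \<and> \<not> E b w}" "cliq E R {w \<in> R. E b w \<and> \<not> E a w}"
  obtains F where "\<And>K. K \<in> F \<Longrightarrow> cliq E (R \<union> {a, b}) K"
    "\<And>x w. x \<in> {a, b} \<Longrightarrow> w \<in> R \<Longrightarrow> E x w \<Longrightarrow> \<exists>K \<in> F. x \<in> K \<and> w \<in> K"
    "\<exists>K \<in> F. a \<in> K \<and> b \<in> K"
    "\<And>x. x \<in> {a, b} \<Longrightarrow> valency F x \<le> k + 1"
    "\<And>w. w \<in> R \<Longrightarrow> valency F w \<le> 1"
proof -
  let ?W = "{w \<in> R. E a w \<and> E b w}"
  let ?A = "insert a {w \<in> R. E a w \<and> \<not> E b w}"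
  let ?B = "insert b {w \<in> R. E b w \<and> \<not> E a w}"
  have sym: "E v u" if "E u v" for u v using assms(1) that by (rule sympD)
  have "a \<noteq> b" using assms(2,5) by (auto dest: irreflpD)
  have X: "cliq E {a, b} {a, b}" "{a, b} \<inter> ?W = {}"
    and join: "\<And>x w. x \<in> {a, b} \<Longrightarrow> w \<in> ?W \<Longrightarrow> E x w"
    using assms(3-5) sym[OF assms(5)] by (auto simp: cliq_def)
  obtain F where F:
    "\<And>K. K \<in> F \<Longrightarrow> cliq E ({a, b} \<union> ?W) K"
    "\<And>w. w \<in> ?W \<Longrightarrow> \<exists>K \<in> F. insert w {a, b} \<subseteq> K"
    "0 < k \<Longrightarrow> \<exists>K \<in> F. {a, b} \<subseteq> K"
    "\<And>v. valency F v \<le> k" "\<And>w. w \<in> ?W \<Longrightarrow> valency F w \<le> 1"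
    using join_family[OF assms(1,7) X join] by blast
  let ?F = "insert ?A (insert ?B F)"
  have AB: "cliq E (R \<union> {a, b}) ?A" "cliq E (R \<union> {a, b}) ?B"
    using assms(8,9) sym unfolding cliq_def by blast+
  have val: "valency ?F v \<le> (if v \<in> ?A then 1 else 0) + ((if v \<in> ?B then 1 else 0) + valency F v)" for v
    using valency_insert[of ?A "insert ?B F" v] valency_insert[of ?B F v] by linarith
  show ?thesis
  proof (rule that[of ?F])
    fix K assume "K \<in> ?F"
    then consider "K = ?A" | "K = ?B" | "K \<in> F" by blast
    then show "cliq E (R \<union> {a, b}) K"
    proof cases
      case 3
      from F(1)[OF this] show ?thesis by (rule cliq_mono) auto
    qed (use AB in auto)
  next
    fix x w assume *: "x \<in> {a, b}" "w \<in> R" "E x w"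
    show "\<exists>K \<in> ?F. x \<in> K \<and> w \<in> K"
    proof (cases "w \<in> ?W")
      case True
      then show ?thesis using F(2)[OF True] * by auto
    next
      case False
      then show ?thesis using * by auto
    qed
  next
    show "\<exists>K \<in> ?F. a \<in> K \<and> b \<in> K" using F(3) assms(6) by auto
  next
    fix x assume "x \<in> {a, b}"
    then show "valency ?F x \<le> k + 1"
      using val[of x] F(4)[of x] assms(3,4) \<open>a \<noteq> b\<close> by auto
  next
    fix w assume w: "w \<in> R"
    then have ne: "w \<noteq> a" "w \<noteq> b" using assms(3,4) by auto
    show "valency ?F w \<le> 1"
    proof (cases "w \<in> ?W")
      case True
      then show ?thesis using val[of w] F(5)[OF True] ne by simp
    next
      case False
      then have "valency F w = 0" using F(1) ne by (intro valency_eq_0) (auto simp: cliq_def)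
      then show ?thesis using val[of w] ne by (simp split: if_splits)
    qed
  qed
qed

section \<open>The upper bound\<close>

text \<open>The triple needs one colour, so restoring its three vertices raises the allowed valency
  by at least two. Claw-freeness gives each remaining vertex at most two neighbours in the triple,
  and no edge inside the triple has to be covered.\<close>

lemma coverable_remove_triple:
  assumes "finite V" "symp E" "irreflp E"
    and claw: "\<And>v a b c. v \<in> V \<Longrightarrow> a \<in> V \<Longrightarrow> b \<in> V \<Longrightarrow> c \<in> V \<Longrightarrow> nonadj E a b \<Longrightarrow> nonadj E b c
      \<Longrightarrow> nonadj E a c \<Longrightarrow> E v a \<Longrightarrow> E v b \<Longrightarrow> E v c \<Longrightarrow> False"
    and S: "a \<in> V" "b \<in> V" "c \<in> V" "nonadj E a b" "nonadj E b c" "nonadj E a c"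
    and cov: "coverable E (V - {a, b, c}) (card (V - {a, b, c}) + 1 - chi E (V - {a, b, c}))"
  shows "coverable E V (card V + 1 - chi E V)"
proof -
  define R where "R = V - {a, b, c}"
  define m where "m = card V + 1 - chi E V"
  have V: "R \<union> {a, b, c} = V" "R \<inter> {a, b, c} = {}" "R \<subseteq> V" "finite R"
    using S(1-3) assms(1) by (auto simp: R_def)
  have ne: "a \<noteq> b" "b \<noteq> c" "a \<noteq> c" and nE: "\<not> E a b" "\<not> E b c" "\<not> E a c" "\<not> E b a" "\<not> E c b" "\<not> E c a"
    and irr: "\<And>x. \<not> E x x" and sym: "\<And>u v. E u v \<Longrightarrow> E v u"
    using S(4-6) assms(2,3) by (auto simp: nonadj_def dest: sympD irreflpD)
  have "card V = card R + card {a, b, c}"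
    using V by (metis card_Un_disjoint finite.emptyI finite_insert)
  then have cardV: "card V = card R + 3" using ne by simp
  have "chi E (R \<union> {a, b, c}) \<le> Suc (chi E R)"
    using V(4) assms(3) by (rule chi_Un_independent) (use nE irr in auto)
  \<comment> \<open>The bound \<open>chi E R \<le> card R\<close> keeps the natural-number
    subtraction from truncating.\<close>
  then have "card R + 1 - chi E R + 2 \<le> m"
    unfolding m_def using V(1) cardV chi_le_card[OF V(4) assms(3)] by simp
  have col: "colorable (nonadj E) {w \<in> R. E x w} m" for x
  proof (rule colorable_mono[OF colorable_chi])
    show "chi (nonadj E) {w \<in> R. E x w} \<le> m"
      unfolding m_def using chi_nonadj_subset[OF assms(1-3), of "{w \<in> R. E x w}"] V(3) by fastforce
  qed (use V(4) nonadj_irrefl in auto)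
  have nR: "a \<notin> R" "b \<notin> R" "c \<notin> R" by (auto simp: R_def)
  obtain A where A: "\<And>K. K \<in> A \<Longrightarrow> cliq E (insert a R) K"
    "\<And>w. w \<in> R \<Longrightarrow> E a w \<Longrightarrow> \<exists>K \<in> A. a \<in> K \<and> w \<in> K" "valency A a \<le> m"
    "\<And>w. w \<in> R \<Longrightarrow> valency A w \<le> (if E a w then 1 else 0)"
    "\<And>w. w \<notin> insert a R \<Longrightarrow> valency A w = 0"
    using vertex_family[OF assms(2) nR(1) col] by blast
  obtain B where B: "\<And>K. K \<in> B \<Longrightarrow> cliq E (insert b R) K"
    "\<And>w. w \<in> R \<Longrightarrow> E b w \<Longrightarrow> \<exists>K \<in> B. b \<in> K \<and> w \<in> K" "valency B b \<le> m"
    "\<And>w. w \<in> R \<Longrightarrow> valency B w \<le> (if E b w then 1 else 0)"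
    "\<And>w. w \<notin> insert b R \<Longrightarrow> valency B w = 0"
    using vertex_family[OF assms(2) nR(2) col] by blast
  obtain C where C: "\<And>K. K \<in> C \<Longrightarrow> cliq E (insert c R) K"
    "\<And>w. w \<in> R \<Longrightarrow> E c w \<Longrightarrow> \<exists>K \<in> C. c \<in> K \<and> w \<in> K" "valency C c \<le> m"
    "\<And>w. w \<in> R \<Longrightarrow> valency C w \<le> (if E c w then 1 else 0)"
    "\<And>w. w \<notin> insert c R \<Longrightarrow> valency C w = 0"
    using vertex_family[OF assms(2) nR(3) col] by blast
  let ?F = "A \<union> (B \<union> C)"
  have val: "valency ?F v \<le> valency A v + (valency B v + valency C v)" for v
    using valency_Un[of A "B \<union> C" v] valency_Un[of B C v] by linarith
  have "coverable E (R \<union> {a, b, c}) m"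
  proof (rule coverable_extend[OF assms(2) cov[folded R_def] V(2)])
    fix K assume "K \<in> ?F"
    then consider "cliq E (insert a R) K" | "cliq E (insert b R) K" | "cliq E (insert c R) K"
      using A(1) B(1) C(1) by blast
    then show "cliq E (R \<union> {a, b, c}) K" by cases (erule cliq_mono, blast)+
  next
    fix u v assume "u \<in> {a, b, c}" "v \<in> R \<union> {a, b, c}" "E u v"
    then have "v \<in> R" using nE irr by auto
    with \<open>u \<in> {a, b, c}\<close> \<open>E u v\<close> show "\<exists>K \<in> ?F. u \<in> K \<and> v \<in> K"
      using A(2)[of v] B(2)[of v] C(2)[of v] by blast
  next
    fix v assume v: "v \<in> R"
    have "\<not> (E v a \<and> E v b \<and> E v c)" using claw[of v a b c] S v V(3) by auto
    then have "\<not> (E a v \<and> E b v \<and> E c v)" using sym by blast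
    then show "valency ?F v \<le> 2"
      using val[of v] A(4)[OF v] B(4)[OF v] C(4)[OF v] by (auto split: if_splits)
  next
    fix v assume "v \<in> {a, b, c}"
    then show "valency ?F v \<le> m"
      using val[of v] A(3,5) B(3,5) C(3,5) nR ne by auto
  qed fact
  then show ?thesis using V(1) m_def by simp
qed

text \<open>Each pair needs one colour, so four vertices return for two colours and the allowed
  valency rises by at least two. The families for the edges \<open>a1 a2\<close> and
  \<open>b1 b2\<close> cost each remaining vertex at most one apiece; possible cross edges are
  covered separately.\<close>

lemma coverable_remove_two_pairs:
  assumes "finite V" "symp E" "irreflp E"
    and tri: "\<And>a b c. a \<in> V \<Longrightarrow> b \<in> V \<Longrightarrow> c \<in> V \<Longrightarrow> nonadj E a b \<Longrightarrow> nonadj E b c \<Longrightarrow> nonadj E a c \<Longrightarrow> False"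
    and S: "a1 \<in> V" "b1 \<in> V" "a2 \<in> V" "b2 \<in> V" "nonadj E a1 b1" "nonadj E a2 b2" "E a1 a2" "E b1 b2"
      "a1 \<noteq> b2" "b1 \<noteq> a2"
    and cov: "coverable E (V - {a1, b1, a2, b2})
      (card (V - {a1, b1, a2, b2}) + 1 - chi E (V - {a1, b1, a2, b2}))"
  shows "coverable E V (card V + 1 - chi E V)"
proof -
  let ?S = "{a1, b1, a2, b2}"
  define R where "R = V - ?S"
  define m where "m = card V + 1 - chi E V"
  have V: "R \<union> ?S = V" "R \<inter> ?S = {}" "R \<subseteq> V" "finite R"
    using S(1-4) assms(1) by (auto simp: R_def)
  have irr: "\<And>x. \<not> E x x" and sym: "\<And>u v. E u v \<Longrightarrow> E v u"
    using assms(2,3) by (auto dest: sympD irreflpD)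
  have ne: "a1 \<noteq> b1" "a2 \<noteq> b2" "a1 \<noteq> a2" "b1 \<noteq> b2" and nE: "\<not> E a1 b1" "\<not> E b1 a1" "\<not> E a2 b2" "\<not> E b2 a2"
    using S(5-8) irr sym unfolding nonadj_def by blast+
  have "card V = card R + card ?S"
    using V by (metis card_Un_disjoint finite.emptyI finite_insert)
  then have cardV: "card V = card R + 4" using ne S(9,10) by simp
  have "chi E (R \<union> {a1, b1}) \<le> Suc (chi E R)"
    using V(4) assms(3) by (rule chi_Un_independent) (use nE irr in auto)
  moreover have "chi E ((R \<union> {a1, b1}) \<union> {a2, b2}) \<le> Suc (chi E (R \<union> {a1, b1}))"
    by (rule chi_Un_independent) (use nE irr V(4) assms(3) in auto)
  moreover have "(R \<union> {a1, b1}) \<union> {a2, b2} = V" using V(1) by auto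
  ultimately have chi: "chi E V \<le> chi E R + 2" by simp
  then have km: "card R + 1 - chi E R + 2 \<le> m" and m: "3 \<le> m"
    unfolding m_def using cardV chi_le_card[OF V(4) assms(3)] by simp_all
  \<comment> \<open>The clique partition bound is taken relative to \<open>R\<close> instead of
    \<open>V\<close>, which saves two. A restored vertex needs this reserve: one for the clique of
    its private neighbours and one for a cross edge.\<close>
  have col: "colorable (nonadj E) {w \<in> R. E x w \<and> E y w} (m - 2)" for x y
  proof (rule colorable_mono[OF colorable_chi])
    have "chi (nonadj E) {w \<in> R. E x w \<and> E y w} + chi E R \<le> card R + 1"
      using chi_nonadj_subset[OF V(4) assms(2,3), of "{w \<in> R. E x w \<and> E y w}"] by fastforce
    then show "chi (nonadj E) {w \<in> R. E x w \<and> E y w} \<le> m - 2"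
      using km by simp
  qed (use V(4) nonadj_irrefl in auto)
  \<comment> \<open>Two nonadjacent vertices that both miss \<open>y\<close> would form an
    independent triple with it.\<close>
  have cl: "cliq E R {w \<in> R. E x w \<and> \<not> E y w}" if "y \<in> ?S" for x y
    unfolding cliq_def
  proof (intro conjI ballI impI)
    fix u v assume uv: "u \<in> {w \<in> R. E x w \<and> \<not> E y w}" "v \<in> {w \<in> R. E x w \<and> \<not> E y w}" "u \<noteq> v"
    moreover have "y \<in> V" "y \<noteq> u" "y \<noteq> v" using that V uv by auto
    ultimately show "E u v" using tri[of y u v] V(3) unfolding nonadj_def by blast
  qed auto
  have nR: "a1 \<notin> R" "b1 \<notin> R" "a2 \<notin> R" "b2 \<notin> R" by (auto simp: R_def)
  have "0 < m - 2" using m by simp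
  have mem: "a1 \<in> ?S" "b1 \<in> ?S" "a2 \<in> ?S" "b2 \<in> ?S" by auto
  obtain A where A: "\<And>K. K \<in> A \<Longrightarrow> cliq E (R \<union> {a1, a2}) K"
    "\<And>x w. x \<in> {a1, a2} \<Longrightarrow> w \<in> R \<Longrightarrow> E x w \<Longrightarrow> \<exists>K \<in> A. x \<in> K \<and> w \<in> K"
    "\<exists>K \<in> A. a1 \<in> K \<and> a2 \<in> K" "\<And>x. x \<in> {a1, a2} \<Longrightarrow> valency A x \<le> m - 2 + 1"
    "\<And>w. w \<in> R \<Longrightarrow> valency A w \<le> 1"
    using edge_family[OF assms(2,3) nR(1,3) S(7) \<open>0 < m - 2\<close> col cl[OF mem(3)] cl[OF mem(1)]] by blast
  obtain B where B: "\<And>K. K \<in> B \<Longrightarrow> cliq E (R \<union> {b1, b2}) K"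
    "\<And>x w. x \<in> {b1, b2} \<Longrightarrow> w \<in> R \<Longrightarrow> E x w \<Longrightarrow> \<exists>K \<in> B. x \<in> K \<and> w \<in> K"
    "\<exists>K \<in> B. b1 \<in> K \<and> b2 \<in> K" "\<And>x. x \<in> {b1, b2} \<Longrightarrow> valency B x \<le> m - 2 + 1"
    "\<And>w. w \<in> R \<Longrightarrow> valency B w \<le> 1"
    using edge_family[OF assms(2,3) nR(2,4) S(8) \<open>0 < m - 2\<close> col cl[OF mem(4)] cl[OF mem(2)]] by blast
  \<comment> \<open>The cross edges, each present only if it is an edge. They are disjoint, so each
    vertex of \<open>?S\<close> lies in at most one of them.\<close>
  define X where "X = {K. K = {a1, b2} \<and> E a1 b2 \<or> K = {b1, a2} \<and> E b1 a2}"
  let ?F = "X \<union> (A \<union> B)"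
  have val: "valency ?F v \<le> valency X v + (valency A v + valency B v)" for v
    using valency_Un[of X "A \<union> B" v] valency_Un[of A B v] by linarith
  have zero: "valency A b1 = 0" "valency A b2 = 0" "valency B a1 = 0" "valency B a2 = 0"
  proof -
    have "b1 \<notin> R \<union> {a1, a2}" "b2 \<notin> R \<union> {a1, a2}" "a1 \<notin> R \<union> {b1, b2}" "a2 \<notin> R \<union> {b1, b2}"
      using nR ne S(9,10) by auto
    then show "valency A b1 = 0" "valency A b2 = 0" "valency B a1 = 0" "valency B a2 = 0"
      using A(1) B(1) unfolding cliq_def by (blast intro: valency_eq_0)+
  qed
  have X1: "valency X x \<le> 1" if "x \<in> ?S" for x
  proof -
    have "{K \<in> X. x \<in> K} \<subseteq> {if x = a1 \<or> x = b2 then {a1, b2} else {b1, a2}}"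
      using that ne S(9,10) unfolding X_def by auto
    then show ?thesis unfolding valency_def
      using card_mono[of "{if x = a1 \<or> x = b2 then {a1, b2} else {b1, a2}}"] by simp
  qed
  have "coverable E (R \<union> ?S) m"
  proof (rule coverable_extend[OF assms(2) cov[folded R_def] V(2)])
    fix K assume "K \<in> ?F"
    then consider "K \<in> X" | "cliq E (R \<union> {a1, a2}) K" | "cliq E (R \<union> {b1, b2}) K"
      using A(1) B(1) by blast
    then show "cliq E (R \<union> ?S) K"
    proof cases
      case 1
      then show ?thesis unfolding X_def cliq_def using sym V(1) by blast
    next
      case 2
      then show ?thesis by (rule cliq_mono) auto
    next
      case 3
      then show ?thesis by (rule cliq_mono) auto
    qed
  next
    fix u v assume u: "u \<in> ?S" "v \<in> R \<union> ?S" "E u v"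
    show "\<exists>K \<in> ?F. u \<in> K \<and> v \<in> K"
    proof (cases "v \<in> R")
      case True
      then show ?thesis using A(2)[of u v] B(2)[of u v] u by blast
    next
      case False
      then have "v \<in> ?S" using u(2) by blast
      \<comment> \<open>Of the sixteen choices of \<open>u\<close> and \<open>v\<close>, equal
        vertices and the two given pairs are not edges; up to symmetry \<open>a1 a2\<close>,
        \<open>b1 b2\<close> and the two cross edges are left.\<close>
      define cov where "cov x y \<longleftrightarrow> (\<exists>K \<in> ?F. x \<in> K \<and> y \<in> K)" for x y
      have cov_sym: "cov y x" if "cov x y" for x y
        using that unfolding cov_def by blast
      have covI: "cov x y" if "K \<in> ?F" "x \<in> K" "y \<in> K" for x y K
        using that unfolding cov_def by (intro bexI[of _ K] conjI)
      have aabb: "cov a1 a2" "cov b1 b2" using A(3) B(3) unfolding cov_def by blast+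
      have ab: "cov a1 b2" if "E a1 b2"
        by (rule covI[of "{a1, b2}"]) (simp_all add: X_def that)
      have ba: "cov b1 a2" if "E b1 a2"
        by (rule covI[of "{b1, a2}"]) (simp_all add: X_def that)
      note edges = aabb ab ba
      have "cov u v"
        using u(1) \<open>v \<in> ?S\<close> u(3) sym[OF u(3)] nE irr edges edges[THEN cov_sym]
        by (elim insertE emptyE) simp_all
      then show ?thesis unfolding cov_def .
    qed
  next
    fix v assume v: "v \<in> R"
    have "valency X v = 0" using v nR unfolding X_def by (intro valency_eq_0) auto
    then show "valency ?F v \<le> 2"
      using val[of v] A(5)[OF v] B(5)[OF v] by simp
  next
    fix v assume v: "v \<in> ?S"
    have "valency A v + valency B v \<le> m - 2 + 1"
      using v zero A(4)[of v] B(4)[of v] by auto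
    then show "valency ?F v \<le> m"
      using val[of v] X1[OF v] m by simp
  qed fact
  then show ?thesis using V(1) m_def by simp
qed

text \<open>Nonadjacent pairs that always meet and form no triangle form a star. Without its centre
  \<open>c\<close> the graph is a clique, so \<open>V - {c}\<close> and the closed neighbourhood of
  \<open>c\<close> cover all edges with valency at most two.\<close>

lemma coverable_no_disjoint_pairs:
  assumes "finite V" "symp E" "irreflp E"
    and tri: "\<And>a b c. a \<in> V \<Longrightarrow> b \<in> V \<Longrightarrow> c \<in> V \<Longrightarrow> nonadj E a b \<Longrightarrow> nonadj E b c \<Longrightarrow> nonadj E a c \<Longrightarrow> False"
    and pairs: "\<And>a b c d. a \<in> V \<Longrightarrow> b \<in> V \<Longrightarrow> c \<in> V \<Longrightarrow> d \<in> V \<Longrightarrow> nonadj E a b \<Longrightarrow> nonadj E c d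
      \<Longrightarrow> a \<noteq> c \<Longrightarrow> a \<noteq> d \<Longrightarrow> b \<noteq> c \<Longrightarrow> b \<noteq> d \<Longrightarrow> False"
  shows "coverable E V (card V + 1 - chi E V)"
proof (cases "cliq E V V")
  case True
  have "valency {V} v \<le> 1" for v
    using valency_insert[of V "{}" v] by (simp add: valency_empty split: if_splits)
  moreover have "1 \<le> card V + 1 - chi E V"
    using chi_le_card[OF assms(1,3)] by simp
  ultimately show ?thesis
    unfolding coverable_def using True
    by (intro exI[of _ "{V}"]) (auto intro: order_trans)
next
  case False
  have sym: "E v u" if "E u v" for u v using assms(2) that by (rule sympD)
  have nsym: "nonadj E v u" if "nonadj E u v" for u v
    using that sym unfolding nonadj_def by blast
  from False obtain a b where ab: "a \<in> V" "b \<in> V" "nonadj E a b"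
    unfolding cliq_def nonadj_def by blast
  \<comment> \<open>If neither works, some nonadjacent pair avoids \<open>a\<close> and hence
    contains \<open>b\<close>, and some pair avoids \<open>b\<close> and hence contains
    \<open>a\<close>. If their other ends agree there is an independent triple, otherwise two
    disjoint nonadjacent pairs.\<close>
  have "\<exists>c \<in> {a, b}. cliq E V (V - {c})"
  proof (rule ccontr)
    assume "\<not> ?thesis"
    then have "\<not> cliq E V (V - {a})" "\<not> cliq E V (V - {b})" by auto
    then obtain x y z w where xy: "x \<in> V" "y \<in> V" "x \<noteq> a" "y \<noteq> a" "nonadj E x y"
      and zw: "z \<in> V" "w \<in> V" "z \<noteq> b" "w \<noteq> b" "nonadj E z w"
      unfolding cliq_def nonadj_def by auto
    obtain x' where x': "x' \<in> V" "x' \<noteq> a" "nonadj E b x'"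
      using pairs[of a b x y] ab xy nsym by metis
    obtain z' where z': "z' \<in> V" "z' \<noteq> b" "nonadj E a z'"
      using pairs[of a b z w] ab zw nsym by metis
    show False
    proof (cases "x' = z'")
      case True
      then show False using tri[of a b x'] ab x' z' by blast
    next
      case False
      then show False using pairs[of b x' a z'] ab x' z' by (auto simp: nonadj_def)
    qed
  qed
  then obtain c where c: "c \<in> V" "cliq E V (V - {c})" using ab by auto
  let ?N = "insert c {w \<in> V. E c w}"
  have N: "cliq E V ?N"
    unfolding cliq_def
  proof (intro conjI ballI impI)
    fix u v assume uv: "u \<in> ?N" "v \<in> ?N" "u \<noteq> v"
    show "E u v"
    proof (cases "u = c \<or> v = c")
      case True
      then show ?thesis using uv sym[of c u] by auto
    next
      case False
      then show ?thesis using uv c(2) unfolding cliq_def by simp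
    qed
  qed (use c in auto)
  have "valency {V - {c}, ?N} v \<le> 2" for v
    using valency_insert[of "V - {c}" "{?N}" v] valency_insert[of "?N" "{}" v]
    by (simp add: valency_empty split: if_splits)
  \<comment> \<open>Giving the nonadjacent \<open>a\<close> and \<open>b\<close> one colour shows
    \<open>chi E V \<le> card V - 1\<close>.\<close>
  moreover have "2 \<le> card V + 1 - chi E V"
  proof -
    let ?R = "V - {a, b}"
    have "chi E (?R \<union> {a, b}) \<le> Suc (chi E ?R)"
      using ab(3) sym assms(1,3) by (intro chi_Un_independent) (auto simp: nonadj_def dest: irreflpD)
    moreover have V: "?R \<union> {a, b} = V" using ab by auto
    moreover have "card (?R \<union> {a, b}) = card ?R + card {a, b}"
      using assms(1) by (intro card_Un_disjoint) auto
    moreover have "card {a, b} = 2" using ab(3) by (simp add: nonadj_def)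
    ultimately show ?thesis
      using chi_le_card[of ?R E] assms(1,3) unfolding V by simp
  qed
  moreover have "\<exists>K \<in> {V - {c}, ?N}. u \<in> K \<and> v \<in> K" if "u \<in> V" "v \<in> V" "E u v" for u v
    using that sym[OF that(3)] by (cases "u = c"; cases "v = c") auto
  ultimately show ?thesis
    unfolding coverable_def using c(2) N
    by (intro exI[of _ "{V - {c}, ?N}"]) (blast intro: order_trans)
qed

text \<open>Strong induction over proper subsets. The claw condition is part of the induction
  statement; it quantifies over vertices of \<open>V\<close> and so passes to subsets.\<close>

lemma coverable_claw_free:
  assumes "finite V" "symp E" "irreflp E"
    and claw: "\<And>v a b c. v \<in> V \<Longrightarrow> a \<in> V \<Longrightarrow> b \<in> V \<Longrightarrow> c \<in> V \<Longrightarrow> nonadj E a b \<Longrightarrow> nonadj E b c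
      \<Longrightarrow> nonadj E a c \<Longrightarrow> E v a \<Longrightarrow> E v b \<Longrightarrow> E v c \<Longrightarrow> False"
  shows "coverable E V (card V + 1 - chi E V)"
  using assms(1) claw
proof (induction V rule: finite_psubset_induct)
  case (psubset V)
  have IH: "coverable E R (card R + 1 - chi E R)" if "R \<subset> V" for R
  proof (rule psubset.IH[OF that])
    fix v a b c
    assume "v \<in> R" "a \<in> R" "b \<in> R" "c \<in> R"
      and *: "nonadj E a b" "nonadj E b c" "nonadj E a c" "E v a" "E v b" "E v c"
    then have "v \<in> V" "a \<in> V" "b \<in> V" "c \<in> V" using that by auto
    from psubset.prems[OF this *] show False .
  qed
  have sym: "E v u" if "E u v" for u v using assms(2) that by (rule sympD)
  show ?case
  proof (cases "\<exists>a \<in> V. \<exists>b \<in> V. \<exists>c \<in> V. nonadj E a b \<and> nonadj E b c \<and> nonadj E a c")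
    case True
    then obtain a b c where S: "a \<in> V" "b \<in> V" "c \<in> V" "nonadj E a b" "nonadj E b c" "nonadj E a c"
      by blast
    show ?thesis
    proof (rule coverable_remove_triple[OF psubset.hyps assms(2,3) _ S])
      show "coverable E (V - {a, b, c}) (card (V - {a, b, c}) + 1 - chi E (V - {a, b, c}))"
        by (rule IH) (use S in auto)
    qed (erule (9) psubset.prems)
  next
    case tri: False
    show ?thesis
    proof (cases "\<exists>a \<in> V. \<exists>b \<in> V. \<exists>c \<in> V. \<exists>d \<in> V. nonadj E a b \<and> nonadj E c d \<and> a \<noteq> c \<and> a \<noteq> d \<and> b \<noteq> c \<and> b \<noteq> d")
      case True
      then obtain a b c d where S: "a \<in> V" "b \<in> V" "c \<in> V" "d \<in> V" "nonadj E a b" "nonadj E c d"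
        and ne: "a \<noteq> c" "a \<noteq> d" "b \<noteq> c" "b \<noteq> d" by blast
      have swap: "nonadj E d c" using S(6) sym unfolding nonadj_def by blast
      \<comment> \<open>otherwise some three of the four vertices are pairwise nonadjacent\<close>
      consider "E a c" "E b d" | "E a d" "E b c"
        using tri S ne sym unfolding nonadj_def by metis
      then show ?thesis
      proof cases
        case 1
        show ?thesis
          by (rule coverable_remove_two_pairs[OF psubset.hyps assms(2,3) _ S(1-6) 1 ne(2,3) IH]) (use tri S in blast)+
      next
        \<comment> \<open>The second pair is read in the order \<open>d\<close>, \<open>c\<close>,
          so that corresponding ends are adjacent.\<close>
        case 2
        show ?thesis
          by (rule coverable_remove_two_pairs[OF psubset.hyps assms(2,3) _ S(1,2,4,3,5) swap 2 ne(1,4) IH]) (use tri S in blast)+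
      qed
    next
      case False
      show ?thesis
        by (rule coverable_no_disjoint_pairs[OF psubset.hyps assms(2,3)]) (use tri False in blast)+
    qed
  qed
qed

section \<open>Transfer from relations to graphs\<close>

lemma (in wf_digraph) chromatic_number_eq_chi:
  "chromatic_number G = chi (\<lambda>u v. (u, v) \<in> arcs_ends G) (verts G)"
proof -
  have "(\<exists>c. proper_coloring G k c) \<longleftrightarrow> colorable (\<lambda>u v. (u, v) \<in> arcs_ends G) (verts G) k" for k
    unfolding proper_coloring_def colorable_def using adj_in_verts by blast
  then show ?thesis unfolding chromatic_number_def chi_def by simp
qed

lemma (in wf_digraph) coverable_iff:
  "coverable (\<lambda>u v. (u, v) \<in> arcs_ends G) (verts G) k \<longleftrightarrow>
    (\<exists>\<C>. clique_covering G \<C> \<and> (\<forall>v \<in> verts G. valency \<C> v \<le> k))"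
proof -
  have "(\<forall>u \<in> verts G. \<forall>v \<in> verts G. (u, v) \<in> arcs_ends G \<longrightarrow> (\<exists>K \<in> \<C>. u \<in> K \<and> v \<in> K)) \<longleftrightarrow>
      (\<forall>(u, v) \<in> arcs_ends G. \<exists>K \<in> \<C>. u \<in> K \<and> v \<in> K)"
      (is "?L \<C> \<longleftrightarrow> ?R \<C>") for \<C>
  proof
    assume L: "?L \<C>"
    show "?R \<C>"
    proof clarify
      fix u v assume uv: "(u, v) \<in> arcs_ends G"
      then show "\<exists>K \<in> \<C>. u \<in> K \<and> v \<in> K" using L adj_in_verts[OF uv] by simp
    qed
  next
    assume R: "?R \<C>"
    show "?L \<C>"
    proof (intro ballI impI)
      fix u v assume "(u, v) \<in> arcs_ends G"
      from bspec[OF R this] show "\<exists>K \<in> \<C>. u \<in> K \<and> v \<in> K" by simp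
    qed
  qed
  then show ?thesis
    unfolding coverable_def clique_covering_def cliq_def clique_def by simp
qed

lemma (in graph) adj_symp_irreflp:
  "symp (\<lambda>u v. (u, v) \<in> arcs_ends G)" "irreflp (\<lambda>u v. (u, v) \<in> arcs_ends G)"
  by (rule sympI, erule arcs_ends_symmetric[OF sym_arcs])
    (rule irreflpI, use adj_not_same in blast)

text \<open>The subgraph induced on the four vertices is a claw with centre
  \<open>v\<close>.\<close>

lemma (in graph) claw_freeD:
  assumes "claw_free G" "v \<in> verts G" "a \<in> verts G" "b \<in> verts G" "c \<in> verts G"
    and "nonadj (\<lambda>u v. (u, v) \<in> arcs_ends G) a b" "nonadj (\<lambda>u v. (u, v) \<in> arcs_ends G) b c"
      "nonadj (\<lambda>u v. (u, v) \<in> arcs_ends G) a c"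
    and "(v, a) \<in> arcs_ends G" "(v, b) \<in> arcs_ends G" "(v, c) \<in> arcs_ends G"
  shows False
proof -
  let ?S = "{v, a, b, c}"
  have irr: "(x, x) \<notin> arcs_ends G" for x using adj_not_same by blast
  have symE: "(y, x) \<in> arcs_ends G" if "(x, y) \<in> arcs_ends G" for x y
    using that by (rule arcs_ends_symmetric[OF sym_arcs])
  have ind: "induced_subgraph (G \<restriction> ?S) G" using assms(2-5) by (intro induced_induce) auto
  have "graph (G \<restriction> ?S)"
    using digraphI_induced[OF ind] induced_graph_imp_graph[OF ind]
    by (simp add: graph_def pseudo_graph_def digraph_def)
  moreover have ends: "arcs_ends (G \<restriction> ?S) = {(x, y) \<in> arcs_ends G. x \<in> ?S \<and> y \<in> ?S}"
    by (auto simp: arcs_ends_conv)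
  have ne: "a \<noteq> b" "b \<noteq> c" "a \<noteq> c" "v \<noteq> a" "v \<noteq> b" "v \<noteq> c"
    and nE: "(a, b) \<notin> arcs_ends G" "(b, c) \<notin> arcs_ends G" "(a, c) \<notin> arcs_ends G"
      "(b, a) \<notin> arcs_ends G" "(c, b) \<notin> arcs_ends G" "(c, a) \<notin> arcs_ends G"
    using assms(6-11) irr symE unfolding nonadj_def by blast+
  have "arcs_ends (G \<restriction> ?S) = {v} \<times> {a, b, c} \<union> {a, b, c} \<times> {v}"
    unfolding ends using assms(9-11) assms(9-11)[THEN symE] nE irr by blast
  moreover have "verts (G \<restriction> ?S) = {v} \<union> {a, b, c}" "{v} \<inter> {a, b, c} = {}"
    "card {v} = 1" "card {a, b, c} = 3" using ne by auto
  ultimately have "K\<^bsub>1,3\<^esub> (G \<restriction> ?S)"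
    unfolding complete_bipartite_digraph_def by blast
  then show False using assms(1) ind unfolding claw_free_def by blast
qed

lemma (in graph) lcc_add_chromatic_number_le:
  assumes "claw_free G"
  shows "lcc G + chromatic_number G \<le> card (verts G) + 1"
proof -
  let ?E = "\<lambda>u v. (u, v) \<in> arcs_ends G"
  have "coverable ?E (verts G) (card (verts G) + 1 - chi ?E (verts G))"
    by (rule coverable_claw_free[OF finite_verts adj_symp_irreflp]) (rule claw_freeD[OF assms])
  then have "lcc G \<le> card (verts G) + 1 - chi ?E (verts G)"
    unfolding lcc_def coverable_iff by (rule Least_le)
  moreover have "chi ?E (verts G) \<le> card (verts G)"
    by (rule chi_le_card[OF finite_verts adj_symp_irreflp(2)])
  ultimately show ?thesis unfolding chromatic_number_eq_chi by simp
qed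

section \<open>The extremal graphs\<close>

text \<open>The three leaves of an induced claw are pairwise nonadjacent in \<open>G\<close>, so it
  is enough that no independent triple exists.\<close>

lemma claw_freeI_independent:
  assumes "\<And>a b c. a \<in> verts G \<Longrightarrow> b \<in> verts G \<Longrightarrow> c \<in> verts G \<Longrightarrow> a \<noteq> b \<Longrightarrow> b \<noteq> c \<Longrightarrow> a \<noteq> c \<Longrightarrow>
    (a, b) \<in> arcs_ends G \<or> (b, c) \<in> arcs_ends G \<or> (a, c) \<in> arcs_ends G"
  shows "claw_free G"
  unfolding claw_free_def
proof
  assume "\<exists>H. induced_subgraph H G \<and> K\<^bsub>1,3\<^esub> H"
  then obtain H where ind: "induced_subgraph H G" and K: "K\<^bsub>1,3\<^esub> H" by blast
  from K obtain U V where "verts H = U \<union> V" "U \<inter> V = {}" "card V = 3"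
    "arcs_ends H = U \<times> V \<union> V \<times> U"
    unfolding complete_bipartite_digraph_def by (elim conjE exE) (rule that)
  note H = ind this
  obtain a b c where V: "V = {a, b, c}" "a \<noteq> b" "b \<noteq> c" "a \<noteq> c"
    using H(4) by (auto simp: card_3_iff)
  have sub: "verts H \<subseteq> verts G" "compatible G H"
    and arcs: "arcs H = {e \<in> arcs G. tail G e \<in> verts H \<and> head G e \<in> verts H}"
    using H(1) unfolding induced_subgraph_def subgraph_def by auto
  have "(x, y) \<in> arcs_ends H" if "x \<in> V" "y \<in> V" "(x, y) \<in> arcs_ends G" for x y
    using that H(2) arcs compatible_tail[OF sub(2)] compatible_head[OF sub(2)]
    by (auto simp: arcs_ends_conv image_iff)
  moreover have "(x, y) \<notin> arcs_ends H" if "x \<in> V" "y \<in> V" for x y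
    using that H(3,5) by auto
  ultimately have "\<And>x y. x \<in> V \<Longrightarrow> y \<in> V \<Longrightarrow> (x, y) \<notin> arcs_ends G" by blast
  moreover have "a \<in> verts G" "b \<in> verts G" "c \<in> verts G" using H(2) V(1) sub(1) by auto
  ultimately show False using assms[of a b c] V by blast
qed

section \<open>Lower bounds for valencies and the chromatic number\<close>

lemma (in graph) clique_covering_finite: "clique_covering G \<C> \<Longrightarrow> finite \<C>"
  by (rule finite_subset[of _ "Pow (verts G)"]) (auto simp: clique_covering_def clique_def)

lemma clique_coveringD:
  "clique_covering G \<C> \<Longrightarrow> (u, v) \<in> arcs_ends G \<Longrightarrow> \<exists>K \<in> \<C>. u \<in> K \<and> v \<in> K"
  unfolding clique_covering_def by (drule conjunct2, drule (1) bspec) simp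

lemma (in graph) valency_pos:
  assumes "clique_covering G \<C>" "(v, u) \<in> arcs_ends G"
  shows "0 < valency \<C> v"
proof -
  obtain K where "K \<in> \<C>" "v \<in> K" using clique_coveringD[OF assms] by blast
  then show ?thesis
    using clique_covering_finite[OF assms(1)] unfolding valency_def by (auto simp: card_gt_0_iff)
qed

text \<open>No clique contains both \<open>u\<close> and \<open>w\<close>, so the edges
  \<open>v u\<close> and \<open>v w\<close> lie in different members.\<close>

lemma (in graph) valency_ge_2:
  assumes "clique_covering G \<C>" "(v, u) \<in> arcs_ends G" "(v, w) \<in> arcs_ends G" "u \<noteq> w" "(u, w) \<notin> arcs_ends G"
  shows "2 \<le> valency \<C> v"
proof -
  obtain K L where KL: "K \<in> \<C>" "v \<in> K" "u \<in> K" "L \<in> \<C>" "v \<in> L" "w \<in> L"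
    using clique_coveringD[OF assms(1,2)] clique_coveringD[OF assms(1,3)] by (elim bexE conjE)
  have "K \<noteq> L"
    using KL assms(1,4,5) unfolding clique_covering_def clique_def by blast
  then have "card {K, L} = 2" by simp
  moreover have "card {K, L} \<le> valency \<C> v"
    unfolding valency_def using clique_covering_finite[OF assms(1)] KL by (intro card_mono) auto
  ultimately show ?thesis by simp
qed

text \<open>The edges themselves form a covering of finite valency, so the minimum in
  \<open>lcc\<close> ranges over a nonempty set.\<close>

lemma (in graph) lcc_attained:
  obtains \<C> where "clique_covering G \<C>" "\<forall>v \<in> verts G. valency \<C> v \<le> lcc G"
proof -
  let ?\<C> = "(\<lambda>(u, v). {u, v}) ` arcs_ends G"
  have "clique G {u, v}" if "(u, v) \<in> arcs_ends G" for u v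
    using that adj_in_verts[OF that] arcs_ends_symmetric[OF sym_arcs that] by (auto simp: clique_def)
  then have "clique_covering G ?\<C>"
    unfolding clique_covering_def by auto
  moreover have "\<forall>v \<in> verts G. valency ?\<C> v \<le> card ?\<C>"
    unfolding valency_def by (auto intro!: card_mono simp: arcs_ends_conv)
  ultimately have "\<exists>k \<C>. clique_covering G \<C> \<and> (\<forall>v \<in> verts G. valency \<C> v \<le> k)" by blast
  from LeastI_ex[OF this] show ?thesis unfolding lcc_def[symmetric] using that by blast
qed

lemma (in graph) chromatic_number_ge_clique:
  assumes "clique G K"
  shows "card K \<le> chromatic_number G"
proof -
  let ?E = "\<lambda>u v. (u, v) \<in> arcs_ends G"
  obtain c where c: "\<forall>v \<in> verts G. c v < chi ?E (verts G)"
    "\<forall>u \<in> verts G. \<forall>v \<in> verts G. ?E u v \<longrightarrow> c u \<noteq> c v"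
    using colorable_chi[OF finite_verts adj_symp_irreflp(2)] unfolding colorable_def by blast
  have "inj_on c K" "c ` K \<subseteq> {..<chi ?E (verts G)}"
    using c assms unfolding clique_def inj_on_def by blast+
  then have "card K \<le> card {..<chi ?E (verts G)}" by (intro card_inj_on_le) auto
  then show ?thesis unfolding chromatic_number_eq_chi by simp
qed

text \<open>The graph \<open>K\<^sub>n\<close> with an extra vertex of degree \<open>d\<close>; it is \<open>K\<^sub>n\<^sub>+\<^sub>1\<close> for \<open>d = n\<close>.\<close>
definition kite :: "nat \<Rightarrow> nat \<Rightarrow> (nat, nat \<times> nat) pre_digraph" where
  "kite n d = \<lparr>verts = {..n},
     arcs = {(u, v). u \<le> n \<and> v \<le> n \<and> u \<noteq> v \<and> (u = n \<longrightarrow> v < d) \<and> (v = n \<longrightarrow> u < d)},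
     tail = fst, head = snd\<rparr>"

lemma verts_kite: "verts (kite n d) = {..n}"
  by (simp add: kite_def)

lemma arcs_kite_iff:
  "(u, v) \<in> arcs (kite n d) \<longleftrightarrow>
    u \<le> n \<and> v \<le> n \<and> u \<noteq> v \<and> (u = n \<longrightarrow> v < d) \<and> (v = n \<longrightarrow> u < d)"
  by (simp add: kite_def)

lemma arcs_ends_kite: "arcs_ends (kite n d) = arcs (kite n d)"
  by (simp add: kite_def arcs_ends_conv)

lemmas kite_simps = verts_kite arcs_kite_iff arcs_ends_kite

lemma arcs_kiteD: "e \<in> arcs (kite n d) \<Longrightarrow> fst e \<le> n \<and> snd e \<le> n \<and> fst e \<noteq> snd e"
  by (cases e) (simp add: arcs_kite_iff)

lemma finite_arcs_kite: "finite (arcs (kite n d))"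
  by (rule finite_subset[of _ "{..n} \<times> {..n}"]) (auto simp: arcs_kite_iff)

lemma graph_kite: "graph (kite n d)"
proof -
  have "symmetric (kite n d)"
    unfolding symmetric_def arcs_ends_kite by (rule symI) (simp add: arcs_kite_iff)
  moreover have "tail (kite n d) = fst" "head (kite n d) = snd" by (simp_all add: kite_def)
  ultimately show ?thesis
    using finite_arcs_kite[of n d]
    by unfold_locales (simp_all add: verts_kite arc_to_ends_def arcs_kiteD)
qed

interpretation kite: graph "kite n d" for n d
  by (rule graph_kite)

text \<open>The number of arcs is the invariant that tells the kites apart; the arc from
  \<open>n\<close> to \<open>d\<close> is new.\<close>

lemma card_arcs_kite_less:
  assumes "d < e" "e \<le> n"
  shows "card (arcs (kite n d)) < card (arcs (kite n e))"
proof (rule psubset_card_mono)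
  show "finite (arcs (kite n e))" by (rule finite_arcs_kite)
  have "(n, d) \<in> arcs (kite n e)" "(n, d) \<notin> arcs (kite n d)"
    using assms by (simp_all add: arcs_kite_iff)
  moreover have "arcs (kite n d) \<subseteq> arcs (kite n e)"
    using assms(1) by (intro subrelI) (auto simp: arcs_kite_iff)
  ultimately show "arcs (kite n d) \<subset> arcs (kite n e)" by blast
qed

text \<open>Among three distinct vertices at least two differ from \<open>n\<close>, and these are
  adjacent.\<close>

lemma claw_free_kite: "claw_free (kite n d)"
proof (rule claw_freeI_independent)
  fix a b c
  assume "a \<in> verts (kite n d)" "b \<in> verts (kite n d)"
    "c \<in> verts (kite n d)" "a \<noteq> b" "b \<noteq> c" "a \<noteq> c"
  moreover have "(x, y) \<in> arcs_ends (kite n d)"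
    if "x \<le> n" "y \<le> n" "x \<noteq> y" "x \<noteq> n" "y \<noteq> n" for x y
    using that by (simp add: kite_simps)
  ultimately show "(a, b) \<in> arcs_ends (kite n d) \<or> (b, c) \<in> arcs_ends (kite n d) \<or>
    (a, c) \<in> arcs_ends (kite n d)"
    by (metis verts_kite atMost_iff)
qed

text \<open>For \<open>d = n\<close> there is a clique on all \<open>n + 1\<close> vertices and
  valency at least one. Otherwise the clique below \<open>n\<close> forces \<open>n\<close> colours,
  and vertex \<open>0\<close> has valency at least two, since its neighbours \<open>n\<close> and
  \<open>n - 1\<close> are nonadjacent.\<close>

lemma lcc_add_chromatic_number_kite:
  assumes "1 \<le> d" "d \<le> n"
  shows "n + 2 \<le> lcc (kite n d) + chromatic_number (kite n d)"
proof -
  obtain \<C> where C: "clique_covering (kite n d) \<C>"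
    "\<forall>v \<in> verts (kite n d). valency \<C> v \<le> lcc (kite n d)"
    by (rule kite.lcc_attained)
  have lcc: "valency \<C> 0 \<le> lcc (kite n d)" using C(2) by (simp add: verts_kite)
  have adj: "(0, n) \<in> arcs_ends (kite n d)" using assms by (simp add: kite_simps)
  show ?thesis
  proof (cases "d = n")
    case True
    have "clique (kite n d) {..n}"
      using True by (simp add: clique_def kite_simps)
    from kite.chromatic_number_ge_clique[OF this] kite.valency_pos[OF C(1) adj] lcc
    show ?thesis by simp
  next
    case False
    have "clique (kite n d) {..<n}"
      by (simp add: clique_def kite_simps subset_iff)
    moreover have "2 \<le> valency \<C> 0"
    proof (rule kite.valency_ge_2[OF C(1) adj])
      show "(0, n - 1) \<in> arcs_ends (kite n d)" "n \<noteq> n - 1" "(n, n - 1) \<notin> arcs_ends (kite n d)"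
        using assms False by (auto simp: kite_simps)
    qed
    ultimately show ?thesis using kite.chromatic_number_ge_clique[of n d "{..<n}"] lcc by simp
  qed
qed

lemma not_digraph_iso_kite:
  assumes "d \<noteq> e" "d \<le> n" "e \<le> n"
  shows "\<not> digraph_iso (kite n d) (kite n e)"
proof
  assume "digraph_iso (kite n d) (kite n e)"
  then obtain f where f: "pre_digraph.digraph_isomorphism (kite n d) f"
    "kite n e = app_iso f (kite n d)"
    unfolding digraph_iso_def by blast
  have "card (arcs (kite n e)) = card (arcs (kite n d))"
    unfolding f(2) using card_arcs_iso[OF f(1)] by simp
  then show False
    using assms card_arcs_kite_less[of d e n] card_arcs_kite_less[of e d n] by linarith
qed

lemma extremal_kites:
  assumes "3 \<le> n"
  shows "\<exists>\<G> :: (nat, nat \<times> nat) pre_digraph set. card \<G> = 3 \<and>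
      pairwise (\<lambda>G H. \<not> digraph_iso G H) \<G> \<and>
      (\<forall>G \<in> \<G>. graph G \<and> claw_free G \<and> card (verts G) = n + 1 \<and>
        lcc G + chromatic_number G = n + 1 + 1)"
proof -
  \<comment> \<open>A pendant vertex, an extra vertex of degree two, and the complete graph; the
    three degrees are distinct because \<open>3 \<le> n\<close>.\<close>
  let ?D = "{1, 2, n}"
  have D: "1 \<le> d \<and> d \<le> n" if "d \<in> ?D" for d using that assms by auto
  have "d = e" if "d \<in> ?D" "e \<in> ?D" "kite n d = kite n e" for d e
    using D[OF that(1)] D[OF that(2)] that(3) card_arcs_kite_less[of d e n] card_arcs_kite_less[of e d n]
    by (metis less_irrefl linorder_neqE_nat)
  then have "card (kite n ` ?D) = card ?D" by (intro card_image inj_onI)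
  then have "card (kite n ` ?D) = 3" using assms by simp
  moreover have "pairwise (\<lambda>G H. \<not> digraph_iso G H) (kite n ` ?D)"
    unfolding pairwise_def
  proof (intro ballI impI)
    fix G H assume "G \<in> kite n ` ?D" "H \<in> kite n ` ?D" "G \<noteq> H"
    then obtain d e where d: "d \<in> ?D" "G = kite n d" and e: "e \<in> ?D" "H = kite n e"
      by (elim imageE)
    with \<open>G \<noteq> H\<close> have "d \<noteq> e" by blast
    then show "\<not> digraph_iso G H"
      unfolding d(2) e(2) using D[OF d(1)] D[OF e(1)] by (intro not_digraph_iso_kite) simp_all
  qed
  moreover have "graph G \<and> claw_free G \<and> card (verts G) = n + 1 \<and> lcc G + chromatic_number G = n + 1 + 1"
    if "G \<in> kite n ` ?D" for G
  proof -
    from that obtain d where d: "d \<in> ?D" "G = kite n d" by (elim imageE)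
    have card: "card (verts (kite n d)) = n + 1" by (simp add: verts_kite)
    have "lcc (kite n d) + chromatic_number (kite n d) = n + 1 + 1"
      using kite.lcc_add_chromatic_number_le[OF claw_free_kite, of n d] card
        lcc_add_chromatic_number_kite[of d n] D[OF d(1)] by simp
    then show ?thesis unfolding d(2) using card graph_kite claw_free_kite by blast
  qed
  ultimately show ?thesis by (intro exI[of _ "kite n ` ?D"]) blast
qed

theorem theorem12:
  shows "(\<forall>G :: ('a, 'b) pre_digraph. graph G \<and> claw_free G \<longrightarrow>
            lcc G + chromatic_number G \<le> card (verts G) + 1) \<and>
         (\<forall>n \<ge> 4. \<exists>\<G> :: (nat, nat \<times> nat) pre_digraph set.
            card \<G> = 3 \<and>
            pairwise (\<lambda>G H. \<not> digraph_iso G H) \<G> \<and>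
            (\<forall>G \<in> \<G>. graph G \<and> claw_free G \<and> card (verts G) = n \<and>
               lcc G + chromatic_number G = n + 1))"
proof (intro conjI allI impI)
  fix G :: "('a, 'b) pre_digraph"
  assume "graph G \<and> claw_free G"
  then show "lcc G + chromatic_number G \<le> card (verts G) + 1"
    by (elim conjE) (rule graph.lcc_add_chromatic_number_le)
next
  fix n :: nat
  assume "4 \<le> n"
  \<comment> \<open>A kite has one vertex more than its first parameter, hence the shift to
    \<open>n - 1\<close>.\<close>
  then have "3 \<le> n - 1" "n - 1 + 1 = n" by simp_all
  with extremal_kites[of "n - 1"] show "\<exists>\<G> :: (nat, nat \<times> nat) pre_digraph set.
      card \<G> = 3 \<and> pairwise (\<lambda>G H. \<not> digraph_iso G H) \<G> \<and>
      (\<forall>G \<in> \<G>. graph G \<and> claw_free G \<and> card (verts G) = n \<and>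
        lcc G + chromatic_number G = n + 1)"
    by (simp only:)
qed

end
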